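(* For $k\in\{1,3\}$, every finite multiset $G$ of I/O pairs and every pair $(B,Y)$: the I/O sequent $G\vdash(B,Y)$ is derivable in the calculus $\mathbf{C}_k$ if and only if $G\vdash_{OUT_k^+}(B,Y)$.
   Context: Formulas are classical propositional formulas built with $\top,\bot,\neg,\wedge,\vee,\to$; $\models$ denotes classical semantic entailment. An I/O pair is an ordered pair $(A,X)$ of formulas. Rules on pairs: (TOP) $(\top,\top)$ is derivable from no premises; (BOT) $(\bot,\bot)$ is derivable from no premises; (WO) from $(A,X)$ derive $(A,Y)$ whenever $X\models Y$; (SI) from $(A,X)$ derive $(B,X)$ whenever $B\models A$; (AND) from $(A,X_1)$ and $(A,X_2)$ derive $(A,X_1\wedge X_2)$; (CT) from $(A,X)$ and $(A\wedge X,Y)$ derive $(A,Y)$. The logic $OUT_1^+$ consists of TOP, BOT, WO, SI, AND; $OUT_3^+$ is $OUT_1^+$ plus CT. $G\vdash_{L}(B,Y)$ means there is a finite tree with root $(B,Y)$, each leaf an element of $G$ or an axiom of $L$, and each non-leaf node obtained from its children by a rule of $L$. An LK sequent $\Gamma\Rightarrow\Delta$ is derivable in LK iff $\bigwedge\Gamma\models\bigvee\Delta$ (empty conjunction $=\top$, empty disjunction $=\bot$). An I/O sequent has the form $G\vdash(B,Y)$ with $G$ a finite multiset of pairs. Rules: (IN) from $B\Rightarrow$ infer $G\vdash(B,Y)$; (OUT) from $\Rightarrow Y$ infer $G\vdash(B,Y)$; (E1) from the LK sequent $B\Rightarrow A$ and $G\vdash(B,Y\vee\neg X)$ infer $(A,X),G\vdash(B,Y)$;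 (E3) from the LK sequent $B\Rightarrow A$ and $G\vdash(B\wedge X,Y\vee\neg X)$ infer $(A,X),G\vdash(B,Y)$. The calculus $\mathbf{C}_1$ has rules IN, OUT, E1; $\mathbf{C}_3$ has IN, OUT, E3. An I/O sequent is derivable in $\mathbf{C}_k$ if it is the root of a finite tree built with its rules in which every LK-sequent premise is derivable in LK. *)

theory Defs
  imports Main "HOL-Library.Multiset"
begin

datatype 'a form =
    Atom 'a
  | Top
  | Bot
  | Neg "'a form"
  | Conj "'a form" "'a form"
  | Disj "'a form" "'a form"
  | Impl "'a form" "'a form"

primrec holds :: "('a \<Rightarrow> bool) \<Rightarrow> 'a form \<Rightarrow> bool" where
  "holds v (Atom p) = v p"
| "holds v Top = True"
| "holds v Bot = False"
| "holds v (Neg X) = (\<not> holds v X)"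
| "holds v (Conj X Y) = (holds v X \<and> holds v Y)"
| "holds v (Disj X Y) = (holds v X \<or> holds v Y)"
| "holds v (Impl X Y) = (holds v X \<longrightarrow> holds v Y)"

definition entails :: "'a form \<Rightarrow> 'a form \<Rightarrow> bool" (infix "\<Turnstile>" 50) where
  "X \<Turnstile> Y \<longleftrightarrow> (\<forall>v. holds v X \<longrightarrow> holds v Y)"

primrec big_conj :: "'a form list \<Rightarrow> 'a form" where
  "big_conj [] = Top"
| "big_conj (X # Xs) = Conj X (big_conj Xs)"

primrec big_disj :: "'a form list \<Rightarrow> 'a form" where
  "big_disj [] = Bot"
| "big_disj (X # Xs) = Disj X (big_disj Xs)"

text \<open>Derivability of LK sequents is taken semantically: a sequent is derivable iff the conjunction
  of its left-hand side entails the disjunction of its right-hand side. Both sides are written as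
  lists; their order and the bracketing do not affect entailment.\<close>

definition LK_derivable :: "'a form list \<Rightarrow> 'a form list \<Rightarrow> bool" where
  "LK_derivable \<Gamma> \<Delta> \<longleftrightarrow> big_conj \<Gamma> \<Turnstile> big_disj \<Delta>"

type_synonym 'a io_pair = "'a form \<times> 'a form"

text \<open>In both predicates below the index selects the logic or calculus and is meant to be 1 or 3.
  The pairs in \<open>G\<close> may be used as leaves any number of times in \<open>OUT_derivable\<close>, so only the
  set of elements of the multiset matters there. In \<open>C_derivable\<close> the elimination rules consume
  one occurrence of a pair.\<close>

inductive OUT_derivable :: "nat \<Rightarrow> 'a io_pair multiset \<Rightarrow> 'a io_pair \<Rightarrow> bool"
  for k :: nat and G :: "'a io_pair multiset" where
  Leaf: "P \<in># G \<Longrightarrow> OUT_derivable k G P"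
| TOP: "OUT_derivable k G (Top, Top)"
| BOT: "OUT_derivable k G (Bot, Bot)"
| WO: "OUT_derivable k G (A, X) \<Longrightarrow> X \<Turnstile> Y \<Longrightarrow> OUT_derivable k G (A, Y)"
| SI: "OUT_derivable k G (A, X) \<Longrightarrow> B \<Turnstile> A \<Longrightarrow> OUT_derivable k G (B, X)"
| AND: "OUT_derivable k G (A, X\<^sub>1) \<Longrightarrow> OUT_derivable k G (A, X\<^sub>2)
    \<Longrightarrow> OUT_derivable k G (A, Conj X\<^sub>1 X\<^sub>2)"
| CT: "k = 3 \<Longrightarrow> OUT_derivable k G (A, X) \<Longrightarrow> OUT_derivable k G (Conj A X, Y)
    \<Longrightarrow> OUT_derivable k G (A, Y)"

inductive C_derivable :: "nat \<Rightarrow> 'a io_pair multiset \<Rightarrow> 'a io_pair \<Rightarrow> bool"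
  for k :: nat where
  IN: "LK_derivable [B] [] \<Longrightarrow> C_derivable k G (B, Y)"
| OUT: "LK_derivable [] [Y] \<Longrightarrow> C_derivable k G (B, Y)"
| E1: "k = 1 \<Longrightarrow> LK_derivable [B] [A] \<Longrightarrow> C_derivable k G (B, Disj Y (Neg X))
    \<Longrightarrow> C_derivable k (add_mset (A, X) G) (B, Y)"
| E3: "k = 3 \<Longrightarrow> LK_derivable [B] [A] \<Longrightarrow> C_derivable k G (Conj B X, Disj Y (Neg X))
    \<Longrightarrow> C_derivable k (add_mset (A, X) G) (B, Y)"

end

(* Both systems are compared with a semantics: a set U of valuations is closed for G and B if U
   satisfies the head of every pair of G whose body follows from B, and (B, Y) is valid if for
   every closed U either B is inconsistent or U satisfies Y. For k = 1 consequence and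
   inconsistency of B refer to all valuations, for k = 3 only to those in U, so that heads
   already obtained count as input.
   The rules of OUT_k^+ preserve validity. For a valid sequent, some pair of G is triggered by B,
   and removing it by E1 or E3 keeps the sequent valid, or none is, and then U = UNIV is closed,
   so that IN or OUT applies. *)
theory Submission
  imports Defs
begin

definition scope :: "nat \<Rightarrow> ('a \<Rightarrow> bool) set \<Rightarrow> ('a \<Rightarrow> bool) set" where
  "scope k U = (if k = 3 then U else UNIV)"

definition closed_for ::
  "nat \<Rightarrow> 'a io_pair multiset \<Rightarrow> 'a form \<Rightarrow> ('a \<Rightarrow> bool) set \<Rightarrow> bool" where
  "closed_for k G B U \<longleftrightarrow>
    (\<forall>A X. (A, X) \<in># G \<longrightarrow> (\<forall>v\<in>scope k U. holds v B \<longrightarrow> holds v A) \<longrightarrow> (\<forall>v\<in>U. holds v X))"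

text \<open>The first alternative accounts for BOT: with SI and WO, an inconsistent input yields
  every output.\<close>

definition io_valid :: "nat \<Rightarrow> 'a io_pair multiset \<Rightarrow> 'a form \<Rightarrow> 'a form \<Rightarrow> bool" where
  "io_valid k G B Y \<longleftrightarrow>
    (\<forall>U. closed_for k G B U \<longrightarrow> (\<forall>v\<in>scope k U. \<not> holds v B) \<or> (\<forall>v\<in>U. holds v Y))"

text \<open>The stronger input \<open>B\<close> triggers every pair that \<open>A\<close> triggers,
  so closure for \<open>B\<close> demands at least as much. This carries closure along SI and
  CT.\<close>

lemma closed_for_antimono:
  assumes "closed_for k G B U" "\<forall>v\<in>scope k U. holds v B \<longrightarrow> holds v A"
  shows "closed_for k G A U"
  using assms unfolding closed_for_def by meson

lemma OUT_derivable_imp_io_valid: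
  assumes "OUT_derivable k G P"
  shows "io_valid k G (fst P) (snd P)"
  using assms
proof induction
  case (Leaf P)
  then show ?case
    by (cases P) (auto simp: io_valid_def closed_for_def)
next
  case (SI A X B)
  have "\<forall>v\<in>scope k U. holds v B \<longrightarrow> holds v A" for U
    using SI.hyps by (simp add: entails_def)
  with SI.IH show ?case
    unfolding io_valid_def fst_conv snd_conv by (meson closed_for_antimono)
next
  case (CT A X Y)
  show ?case
    unfolding io_valid_def fst_conv snd_conv
  proof (intro allI impI)
    fix U assume closed: "closed_for k G A U"
    then consider "\<forall>v\<in>scope k U. \<not> holds v A" | "\<forall>v\<in>U. holds v X"
      using CT.IH(1) by (auto simp: io_valid_def)
    then show "(\<forall>v\<in>scope k U. \<not> holds v A) \<or> (\<forall>v\<in>U. holds v Y)"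
    proof cases
      case 2
      \<comment> \<open>For \<open>k = 3\<close> the scope is \<open>U\<close> itself, so an
        obtained output \<open>X\<close> makes \<open>A\<close> and \<open>Conj A X\<close> agree on
        the scope.\<close>
      then have X: "\<forall>v\<in>scope k U. holds v X"
        using \<open>k = 3\<close> by (simp add: scope_def)
      then have "closed_for k G (Conj A X) U"
        by (intro closed_for_antimono[OF closed]) simp
      with CT.IH(2) X show ?thesis
        by (auto simp: io_valid_def)
    qed blast
  qed
qed (auto simp: io_valid_def entails_def)

text \<open>Cutting \<open>U\<close> down to the valuations of \<open>X\<close> satisfies the pair
  \<open>(A, X)\<close> outright and keeps all other heads, while triggering ignores
  \<open>U\<close>. That \<open>Y\<close> holds on the smaller set means that
  \<open>Disj Y (Neg X)\<close> holds on \<open>U\<close>.\<close>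

lemma io_valid_E1:
  assumes "io_valid 1 (add_mset (A, X) G) B Y"
  shows "io_valid 1 G B (Disj Y (Neg X))"
  unfolding io_valid_def
proof (intro allI impI)
  fix U assume "closed_for 1 G B U"
  then have "closed_for 1 (add_mset (A, X) G) B {v \<in> U. holds v X}"
    by (auto simp: closed_for_def scope_def)
  with assms show "(\<forall>v\<in>scope 1 U. \<not> holds v B) \<or> (\<forall>v\<in>U. holds v (Disj Y (Neg X)))"
    by (fastforce simp: io_valid_def scope_def)
qed

text \<open>The same restriction works, but now it also shrinks the scope: what \<open>B\<close>
  implies on the smaller set is exactly what \<open>Conj B X\<close> implies on \<open>U\<close>,
  and likewise for inconsistency.\<close>

lemma io_valid_E3:
  assumes "io_valid 3 (add_mset (A, X) G) B Y"
  shows "io_valid 3 G (Conj B X) (Disj Y (Neg X))"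
  unfolding io_valid_def
proof (intro allI impI)
  fix U assume "closed_for 3 G (Conj B X) U"
  then have "closed_for 3 (add_mset (A, X) G) B {v \<in> U. holds v X}"
    by (auto simp: closed_for_def scope_def)
  with assms show "(\<forall>v\<in>scope 3 U. \<not> holds v (Conj B X)) \<or> (\<forall>v\<in>U. holds v (Disj Y (Neg X)))"
    by (fastforce simp: io_valid_def scope_def)
qed

lemma io_valid_imp_C_derivable:
  assumes "k \<in> {1, 3}" "io_valid k G B Y"
  shows "C_derivable k G (B, Y)"
  using assms(2)
proof (induction "size G" arbitrary: G B Y rule: less_induct)
  case less
  show ?case
  proof (cases "\<exists>A X. (A, X) \<in># G \<and> B \<Turnstile> A")
    case True
    then obtain A X G' where G: "G = add_mset (A, X) G'" and "B \<Turnstile> A"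
      by (meson mset_add)
    then have BA: "LK_derivable [B] [A]"
      by (simp add: LK_derivable_def entails_def)
    have IH: "io_valid k G' B' Y' \<Longrightarrow> C_derivable k G' (B', Y')" for B' Y'
      by (rule less.hyps) (simp_all add: G)
    show ?thesis
    proof (cases "k = 3")
      case True
      then have "io_valid k G' (Conj B X) (Disj Y (Neg X))"
        using less.prems io_valid_E3 G by blast
      from E3[OF True BA IH[OF this]] show ?thesis
        by (simp only: G)
    next
      case False
      then have "k = 1"
        using assms(1) by simp
      then have "io_valid k G' B (Disj Y (Neg X))"
        using less.prems io_valid_E1 G by blast
      from E1[OF \<open>k = 1\<close> BA IH[OF this]] show ?thesis
        by (simp only: G)
    qed
  next
    case False
    then have "closed_for k G B UNIV"
      by (auto simp: closed_for_def scope_def entails_def)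
    then have "(\<forall>v. \<not> holds v B) \<or> (\<forall>v. holds v Y)"
      using less.prems by (auto simp: io_valid_def scope_def)
    then show ?thesis
      using IN[of B k G Y] OUT[of Y k G B] by (auto simp: LK_derivable_def entails_def)
  qed
qed

lemma OUT_derivable_mono:
  assumes "OUT_derivable k G P" "G \<subseteq># H"
  shows "OUT_derivable k H P"
  using assms by induction (auto intro: OUT_derivable.intros mset_subset_eqD)

text \<open>Removes the disjunct \<open>Neg X\<close> introduced by E1 and E3, by AND followed by a
  resolution step under WO.\<close>

lemma OUT_derivable_detach:
  assumes "OUT_derivable k G (B, X)" "OUT_derivable k G (B, Disj Y (Neg X))"
  shows "OUT_derivable k G (B, Y)"
  by (rule OUT_derivable.WO[OF OUT_derivable.AND[OF assms]]) (auto simp: entails_def)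

lemma C_derivable_imp_OUT_derivable:
  assumes "C_derivable k G P"
  shows "OUT_derivable k G P"
  using assms
proof induction
  case (IN B G Y)
  then have "B \<Turnstile> Bot"
    by (simp add: LK_derivable_def entails_def)
  then have "OUT_derivable k G (B, Bot)"
    by (rule OUT_derivable.SI[OF OUT_derivable.BOT])
  then show ?case
    by (rule OUT_derivable.WO) (simp add: entails_def)
next
  case (OUT Y G B)
  then have "Top \<Turnstile> Y"
    by (simp add: LK_derivable_def entails_def)
  then have "OUT_derivable k G (Top, Y)"
    by (rule OUT_derivable.WO[OF OUT_derivable.TOP])
  then show ?case
    by (rule OUT_derivable.SI) (simp add: entails_def)
next
  case (E1 B A G Y X)
  have "OUT_derivable k (add_mset (A, X) G) (B, X)"
    using E1.hyps by (intro OUT_derivable.SI[OF OUT_derivable.Leaf, of A])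
      (auto simp: LK_derivable_def entails_def)
  moreover have "OUT_derivable k (add_mset (A, X) G) (B, Disj Y (Neg X))"
    using E1.IH by (rule OUT_derivable_mono) simp
  ultimately show ?case
    by (rule OUT_derivable_detach)
next
  case (E3 B A G X Y)
  have BX: "OUT_derivable k (add_mset (A, X) G) (B, X)"
    using E3.hyps by (intro OUT_derivable.SI[OF OUT_derivable.Leaf, of A])
      (auto simp: LK_derivable_def entails_def)
  then have "OUT_derivable k (add_mset (A, X) G) (Conj B X, X)"
    by (rule OUT_derivable.SI) (simp add: entails_def)
  moreover have "OUT_derivable k (add_mset (A, X) G) (Conj B X, Disj Y (Neg X))"
    using E3.IH by (rule OUT_derivable_mono) simp
  ultimately have "OUT_derivable k (add_mset (A, X) G) (Conj B X, Y)"
    by (rule OUT_derivable_detach)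
  \<comment> \<open>CT discharges the extra input \<open>X\<close>, which the restored pair
    \<open>(A, X)\<close> supplies as an output of \<open>B\<close>.\<close>
  with \<open>k = 3\<close> BX show ?case
    by (rule OUT_derivable.CT)
qed

theorem theorem3:
  fixes k :: nat and G :: "'a io_pair multiset" and B Y :: "'a form"
  assumes "k \<in> {1, 3}"
  shows "C_derivable k G (B, Y) \<longleftrightarrow> OUT_derivable k G (B, Y)"
  using C_derivable_imp_OUT_derivable OUT_derivable_imp_io_valid
    io_valid_imp_C_derivable[OF assms] by fastforce

end
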